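(* Wheel graphs are characterized by the alliance polynomial. That is, for every integer $n\ge 4$ and every finite simple graph $G$ (of any order) such that $A(G;x)=A(W_n;x)$, the graph $G$ is isomorphic to the wheel graph $W_n$.
   Context: All graphs are finite, simple, with nonempty vertex set. For a graph $G=(V,E)$ of order $n=|V|$, a vertex $v\in V$ and a set $X\subseteq V$, let $\delta_X(v)$ denote the number of neighbors of $v$ lying in $X$; write $\bar S=V\setminus S$ for $S\subseteq V$, and let $\Delta$ be the maximum degree of $G$. Put $\mathcal K=[-\Delta,\Delta]\cap\mathbb Z$. For $k\in\mathcal K$, a nonempty set $S\subseteq V$ is a defensive $k$-alliance in $G$ if $\delta_S(v)\ge\delta_{\bar S}(v)+k$ for every $v\in S$. For a nonempty $S\subseteq V$, its exact index of alliance is $k_S=\max\{k\in\mathcal K : S\text{ is a defensive }k\text{-alliance}\}$ (this set of $k$ is always nonempty), and $S$ is called an exact defensive $k_S$-alliance. $S$ is called connected if the subgraph of $G$ induced by $S$ is connected. Let $A_k(G)$ be the number of connected exact defensive $k$-alliances in $G$. The alliance polynomial of $G$ is $$A(G;x)=\sum_{k\in\mathcal K}A_k(G)\,x^{n+k}.$$ The wheel graph $W_n$ of order $n\ge4$ is the join $E_1+C_{n-1}$ of a single vertex $E_1$ and the cycle $C_{n-1}$ on $n-1$ vertices, i.e. the cycle $C_{n-1}$ together with one additional (central) vertex adjacent to all vertices of the cycle. *)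

theory Defs
  imports "Graph_Theory.Graph_Theory" "HOL-Computational_Algebra.Polynomial"
begin

text \<open>Graphs are finite simple graphs, i.e. symmetric loop-free finite digraphs without parallel
  arcs (locale \<^locale>\<open>pair_graph\<close>); each undirected edge is the pair of arcs \<open>(u, v)\<close>, \<open>(v, u)\<close>.\<close>

text \<open>\<open>nbrs_in G X v\<close> is $\delta_X(v)$.\<close>

definition nbrs_in :: "'a pair_pre_digraph \<Rightarrow> 'a set \<Rightarrow> 'a \<Rightarrow> nat" where
  "nbrs_in G X v = card {u \<in> X. (v, u) \<in> parcs G}"

text \<open>In a \<^locale>\<open>pair_graph\<close>, \<^const>\<open>out_degree\<close> is the undirected degree.\<close>

definition max_degree :: "'a pair_pre_digraph \<Rightarrow> nat" where
  "max_degree G = Max (out_degree (with_proj G) ` pverts G)"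

definition alliance_range :: "'a pair_pre_digraph \<Rightarrow> int set" where
  "alliance_range G = {- int (max_degree G) .. int (max_degree G)}"

definition defensive_alliance :: "'a pair_pre_digraph \<Rightarrow> int \<Rightarrow> 'a set \<Rightarrow> bool" where
  "defensive_alliance G k S \<longleftrightarrow> S \<noteq> {} \<and> S \<subseteq> pverts G \<and>
     (\<forall>v\<in>S. int (nbrs_in G S v) \<ge> int (nbrs_in G (pverts G - S) v) + k)"

text \<open>Only meaningful for nonempty \<open>S \<subseteq> pverts G\<close>; the set is then nonempty, since it contains
  \<open>- int (max_degree G)\<close>.\<close>

definition alliance_index :: "'a pair_pre_digraph \<Rightarrow> 'a set \<Rightarrow> int" where
  "alliance_index G S = Max {k \<in> alliance_range G. defensive_alliance G k S}"

definition exact_defensive_alliance :: "'a pair_pre_digraph \<Rightarrow> int \<Rightarrow> 'a set \<Rightarrow> bool" where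
  "exact_defensive_alliance G k S \<longleftrightarrow>
     S \<noteq> {} \<and> S \<subseteq> pverts G \<and> alliance_index G S = k"

text \<open>The qualified name avoids confusion with topological connectedness.\<close>

definition connected_in :: "'a pair_pre_digraph \<Rightarrow> 'a set \<Rightarrow> bool" where
  "connected_in G S \<longleftrightarrow> Digraph_Component.connected (with_proj G \<restriction> S)"

definition alliance_count :: "'a pair_pre_digraph \<Rightarrow> int \<Rightarrow> nat" where
  "alliance_count G k = card {S. exact_defensive_alliance G k S \<and> connected_in G S}"

text \<open>The exponents satisfy $n + k \ge n - \Delta \ge 1$, so \<^const>\<open>nat\<close> truncates nothing.\<close>

definition alliance_poly :: "'a pair_pre_digraph \<Rightarrow> int poly" where
  "alliance_poly G = (\<Sum>k\<in>alliance_range G.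
     monom (int (alliance_count G k)) (nat (int (card (pverts G)) + k)))"

definition single_vertex_graph :: "unit pair_pre_digraph" where
  "single_vertex_graph = \<lparr> pverts = {()}, parcs = {} \<rparr>"

text \<open>A simple cycle for \<open>m \<ge> 3\<close>.\<close>

definition cycle_graph :: "nat \<Rightarrow> nat pair_pre_digraph" where
  "cycle_graph m = \<lparr> pverts = {..<m},
     parcs = {(i, j). i < m \<and> j < m \<and> (j = (i + 1) mod m \<or> i = (j + 1) mod m)} \<rparr>"

definition graph_join ::
    "'a pair_pre_digraph \<Rightarrow> 'b pair_pre_digraph \<Rightarrow> ('a + 'b) pair_pre_digraph" where
  "graph_join G H = \<lparr> pverts = pverts G <+> pverts H,
     parcs = map_prod Inl Inl ` parcs G \<union> map_prod Inr Inr ` parcs H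
       \<union> Inl ` pverts G \<times> Inr ` pverts H \<union> Inr ` pverts H \<times> Inl ` pverts G \<rparr>"

definition wheel_graph :: "nat \<Rightarrow> (unit + nat) pair_pre_digraph" where
  "wheel_graph n = graph_join single_vertex_graph (cycle_graph (n - 1))"

end

theory Submission
  imports Defs
begin

text \<open>
  The index of \<open>S\<close> is the minimum over \<open>v \<in> S\<close> of \<open>2 \<delta>\<^sub>S(v) - deg v\<close>. Since the coefficient of \<open>x\<close> in
  \<open>A(W\<^sub>n; x)\<close> is nonzero, \<open>G\<close> has a dominating vertex \<open>c\<close>. With \<open>m\<close> the number of remaining vertices,
  the number \<open>A(G; 1)\<close> of connected sets is \<open>2\<^sup>m\<close> (those containing \<open>c\<close>) plus the number of
  connected sets of \<open>G - c\<close>, which is below \<open>2\<^sup>m\<close>; so \<open>A(G; 1)\<close> determines both summands.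

  If every vertex other than \<open>c\<close> has degree at most \<open>D\<close>, a connected set of index \<open>-D\<close> is either a
  single vertex of degree \<open>D\<close> or contains \<open>c\<close> and has its index attained at \<open>c\<close>; the number of the
  latter sets depends only on \<open>m\<close>. Descending from \<open>D = m\<close> to \<open>D = 3\<close>, the coefficients show that all
  vertices other than \<open>c\<close> have degree 3, so that \<open>G - c\<close> is a disjoint union of cycles. Finally, a
  cycle of length \<open>p\<close> has at most \<open>p\<^sup>2\<close> connected sets, so two or more cycles of total length \<open>m\<close> have
  at most \<open>m\<^sup>2 - m\<close> of them, whereas \<open>C\<^sub>m\<close> has at least \<open>m\<^sup>2 - m + 1\<close>.
\<close>

section \<open>Connected vertex sets\<close>

text \<open>Connectedness phrased by cuts, which is adequate only for symmetric relations.\<close>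

definition conn_set :: "('a \<times> 'a) set \<Rightarrow> 'a set \<Rightarrow> bool" where
  "conn_set r S \<longleftrightarrow> S \<noteq> {} \<and> (\<forall>A. A \<subseteq> S \<and> A \<noteq> {} \<and> r `` A \<inter> S \<subseteq> A \<longrightarrow> A = S)"

lemma conn_setD: "conn_set r S \<Longrightarrow> A \<subseteq> S \<Longrightarrow> A \<noteq> {} \<Longrightarrow> r `` A \<inter> S \<subseteq> A \<Longrightarrow> A = S"
  by (auto simp: conn_set_def)

text \<open>A closed \<open>A\<close> absorbs everything reachable from any of its points;
  conversely, the vertices reachable from a fixed \<open>u\<close> form such an
  \<open>A\<close>.\<close>

lemma rtrancl_on_conn_set:
  "S \<noteq> {} \<and> (\<forall>u\<in>S. \<forall>v\<in>S. (u, v) \<in> rtrancl_on S (r \<inter> S \<times> S)) \<longleftrightarrow> conn_set r S"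
proof
  assume L: "S \<noteq> {} \<and> (\<forall>u\<in>S. \<forall>v\<in>S. (u, v) \<in> rtrancl_on S (r \<inter> S \<times> S))"
  show "conn_set r S"
    unfolding conn_set_def
  proof (intro conjI allI impI)
    fix A assume A: "A \<subseteq> S \<and> A \<noteq> {} \<and> r `` A \<inter> S \<subseteq> A"
    then obtain u where u: "u \<in> A" by auto
    have "v \<in> A" if "v \<in> S" for v
    proof -
      have "(u, v) \<in> rtrancl_on S (r \<inter> S \<times> S)" using L A u that by blast
      then show ?thesis
        by (induction rule: rtrancl_on_induct) (use A u in auto)
    qed
    then show "A = S" using A by auto
  qed (use L in auto)
next
  assume R: "conn_set r S"
  have "(u, v) \<in> rtrancl_on S (r \<inter> S \<times> S)" if "u \<in> S" "v \<in> S" for u v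
  proof -
    let ?A = "{w \<in> S. (u, w) \<in> rtrancl_on S (r \<inter> S \<times> S)}"
    have "?A = S"
      using that by (intro conn_setD[OF R]) (auto intro: rtrancl_on_into_rtrancl_on)
    then show ?thesis using that by auto
  qed
  then show "S \<noteq> {} \<and> (\<forall>u\<in>S. \<forall>v\<in>S. (u, v) \<in> rtrancl_on S (r \<inter> S \<times> S))"
    using R by (auto simp: conn_set_def)
qed

lemma (in pair_graph) connected_in_iff: "connected_in G S \<longleftrightarrow> conn_set (parcs G) S"
proof -
  \<comment> \<open>\<open>connected\<close> is strong connectivity of the symmetric closure, which
    adds nothing to arcs that are already symmetric.\<close>
  have "mk_symmetric (with_proj G \<restriction> S) = \<lparr> pverts = S, parcs = parcs G \<inter> S \<times> S \<rparr>"
    by (auto simp: mk_symmetric_def induce_subgraph_def intro: arcs_symmetric)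
  then show ?thesis
    by (simp add: connected_in_def Digraph_Component.connected_def strongly_connected_def
        reachable_def rtrancl_on_conn_set)
qed

lemma conn_set_singleton [simp]: "conn_set r {v}"
  by (auto simp: conn_set_def)

text \<open>Membership in a closed set spreads along the walk in both directions, downwards by
  symmetry. Since \<open>f\<close> may repeat vertices, walks around a cycle are covered.\<close>

lemma conn_set_path:
  assumes "sym r" "a \<le> b" "\<And>k. a \<le> k \<Longrightarrow> k < b \<Longrightarrow> (f k, f (Suc k)) \<in> r"
  shows "conn_set r (f ` {a..b})"
  unfolding conn_set_def
proof (intro conjI allI impI)
  fix A assume A: "A \<subseteq> f ` {a..b} \<and> A \<noteq> {} \<and> r `` A \<inter> f ` {a..b} \<subseteq> A"
  then obtain x where "x \<in> A" "x \<in> f ` {a..b}" by blast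
  then obtain k where k: "a \<le> k" "k \<le> b" "f k \<in> A" by auto
  have 1: "f j \<in> A" if "k \<le> j" "j \<le> b" for j
    using that
  proof (induction j rule: dec_induct)
    case (step j)
    then have "(f j, f (Suc j)) \<in> r" using assms(3) k by auto
    then show ?case using step A k by auto
  qed (use k in auto)
  have 2: "f j \<in> A" if "j \<le> k" "a \<le> j" for j
    using that
  proof (induction j rule: inc_induct)
    case (step j)
    then have "(f (Suc j), f j) \<in> r" using assms(3)[of j] step k symD[OF assms(1)] by auto
    then show ?case using step A k by auto
  qed (use k in auto)
  have "f j \<in> A" if "j \<in> {a..b}" for j
    using 1[of j] 2[of j] that by (cases "k \<le> j") auto
  then show "A = f ` {a..b}" using A by blast
qed (use assms in auto)

lemma conn_set_isolated:
  assumes "conn_set r S" "v \<in> S" "r `` {v} \<inter> S = {}"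
  shows "S = {v}"
  using conn_setD[OF assms(1), of "{v}"] assms by auto

lemma conn_set_dominating:
  assumes "sym r" "c \<in> S" "\<And>v. v \<in> S \<Longrightarrow> v \<noteq> c \<Longrightarrow> (c, v) \<in> r"
  shows "conn_set r S"
  unfolding conn_set_def
proof (intro conjI allI impI)
  fix A assume A: "A \<subseteq> S \<and> A \<noteq> {} \<and> r `` A \<inter> S \<subseteq> A"
  then obtain v where v: "v \<in> A" by auto
  have "c \<in> A"
  proof (cases "v = c")
    case False
    then have "(v, c) \<in> r" using assms A v by (auto elim: symE)
    then show ?thesis using A v assms by auto
  qed (use v in auto)
  then show "A = S" using A assms(3) by blast
qed (use assms in auto)

section \<open>Coefficients of the alliance polynomial\<close>

text \<open>The largest \<open>k\<close> for which \<open>v\<close> meets the condition of a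
  defensive \<open>k\<close>-alliance \<open>S\<close>.\<close>

definition margin :: "'a pair_pre_digraph \<Rightarrow> 'a set \<Rightarrow> 'a \<Rightarrow> int" where
  "margin G S v = int (nbrs_in G S v) - int (nbrs_in G (pverts G - S) v)"

context pair_graph
begin

lemma finite_nbrs [simp]: "finite (parcs G `` {v})"
  by (rule finite_subset[OF _ pair_finite_verts]) (auto dest: in_arcsD2)

lemma nbrs_in_eq: "nbrs_in G S v = card (S \<inter> parcs G `` {v})"
  by (auto simp: nbrs_in_def intro!: arg_cong[where f = card])

lemma out_degree_eq: "out_degree (with_proj G) v = card (parcs G `` {v})"
proof -
  have "out_arcs (with_proj G) v = Pair v ` (parcs G `` {v})"
    by (auto simp: out_arcs_def)
  then show ?thesis
    unfolding out_degree_def by (simp add: card_image inj_on_def)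
qed

lemma degree_le_max: "v \<in> pverts G \<Longrightarrow> card (parcs G `` {v}) \<le> max_degree G"
  unfolding max_degree_def out_degree_eq using pair_finite_verts by (intro Max_ge) auto

lemma margin_eq:
  assumes "S \<subseteq> pverts G"
  shows "margin G S v = 2 * int (card (S \<inter> parcs G `` {v})) - int (card (parcs G `` {v}))"
proof -
  have "parcs G `` {v} = (S \<inter> parcs G `` {v}) \<union> ((pverts G - S) \<inter> parcs G `` {v})"
    using in_arcsD2 by auto
  then have "card (parcs G `` {v}) =
      card (S \<inter> parcs G `` {v}) + card ((pverts G - S) \<inter> parcs G `` {v})"
    by (metis (no_types, lifting) Diff_disjoint Int_assoc card_Un_disjoint finite_Int finite_nbrs
        inf_bot_left inf_left_commute)
  then show ?thesis by (simp add: margin_def nbrs_in_eq)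
qed

lemma card_nbrs_le: "card (S \<inter> parcs G `` {v}) \<le> card (parcs G `` {v})"
  by (intro card_mono) auto

text \<open>\<open>S\<close> is a defensive \<open>k\<close>-alliance exactly when \<open>k\<close>
  is a lower bound of the margins. Each margin lies between plus and minus the degree of its vertex,
  so the minimum is in \<open>alliance_range G\<close>.\<close>

lemma alliance_index_eq_Min:
  assumes S: "S \<noteq> {}" "S \<subseteq> pverts G"
  shows "alliance_index G S = Min (margin G S ` S)"
  unfolding alliance_index_def
proof (rule Max_eqI)
  have fin: "finite S" using S pair_finite_verts finite_subset by blast
  show "finite {k \<in> alliance_range G. defensive_alliance G k S}"
    by (rule finite_subset[of _ "alliance_range G"]) (auto simp: alliance_range_def)
  show "k \<le> Min (margin G S ` S)" if "k \<in> {k \<in> alliance_range G. defensive_alliance G k S}" for k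
    using that fin S by (force simp: defensive_alliance_def margin_def)
  have "margin G S v \<in> alliance_range G" if "v \<in> S" for v
    using that S degree_le_max[of v] card_nbrs_le[of S v]
    by (auto simp: margin_eq alliance_range_def)
  then have "margin G S ` S \<subseteq> alliance_range G" by auto
  then have "Min (margin G S ` S) \<in> alliance_range G"
    using Min_in[of "margin G S ` S"] fin S by blast
  moreover have "Min (margin G S ` S) \<le> margin G S v" if "v \<in> S" for v
    using that fin by auto
  then have "defensive_alliance G (Min (margin G S ` S)) S"
    using S by (auto simp: defensive_alliance_def margin_def[symmetric] algebra_simps
        le_diff_eq[symmetric])
  ultimately show "Min (margin G S ` S) \<in> {k \<in> alliance_range G. defensive_alliance G k S}"
    by auto
qed

lemma alliance_index_eq_iff:
  assumes S: "S \<noteq> {}" "S \<subseteq> pverts G"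
  shows "alliance_index G S = k \<longleftrightarrow> (\<forall>v\<in>S. k \<le> margin G S v) \<and> (\<exists>v\<in>S. margin G S v = k)"
proof -
  have "finite S" using S pair_finite_verts finite_subset by blast
  then show ?thesis
    using S by (subst alliance_index_eq_Min[OF S], subst Min_eq_iff) auto
qed

lemma alliance_index_in_range:
  assumes S: "S \<noteq> {}" "S \<subseteq> pverts G"
  shows "alliance_index G S \<in> alliance_range G"
proof -
  obtain v where "v \<in> S" "margin G S v = alliance_index G S"
    using alliance_index_eq_iff[OF S] by blast
  then show ?thesis
    using S degree_le_max[of v] card_nbrs_le[of S v] by (auto simp: margin_eq alliance_range_def)
qed

lemma max_degree_less:
  assumes "pverts G \<noteq> {}"
  shows "max_degree G < card (pverts G)"
proof -
  have "card (parcs G `` {v}) < card (pverts G)" if "v \<in> pverts G" for v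
    using that no_loops'[of v v] in_arcsD2 pair_finite_verts by (intro psubset_card_mono) auto
  then show ?thesis
    unfolding max_degree_def out_degree_eq using assms pair_finite_verts by (subst Max_less_iff) auto
qed

text \<open>The maximum degree is below the order, so all exponents are positive and
  \<open>nat\<close> keeps them distinct. For an index outside \<open>alliance_range G\<close> both
  sides vanish, so the formula holds for every \<open>i\<close>.\<close>

lemma coeff_alliance_poly:
  assumes "pverts G \<noteq> {}"
  shows "coeff (alliance_poly G) i = int (alliance_count G (int i - int (card (pverts G))))"
proof -
  let ?j = "int i - int (card (pverts G))"
  have "coeff (alliance_poly G) i =
      (\<Sum>k\<in>alliance_range G. if ?j = k then int (alliance_count G k) else 0)"
    unfolding alliance_poly_def coeff_sum coeff_monom
    using max_degree_less[OF assms]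
    by (intro sum.cong) (auto simp: alliance_range_def)
  also have "\<dots> = (if ?j \<in> alliance_range G then int (alliance_count G ?j) else 0)"
    by (subst sum.delta') (auto simp: alliance_range_def)
  also have "\<dots> = int (alliance_count G ?j)"
  proof (cases "?j \<in> alliance_range G")
    case False
    then have "{S. exact_defensive_alliance G ?j S \<and> connected_in G S} = {}"
      using alliance_index_in_range by (metis (mono_tags, lifting) Collect_empty_eq exact_defensive_alliance_def)
    then have "alliance_count G ?j = 0"
      unfolding alliance_count_def by (metis card.empty)
    then show ?thesis by simp
  qed auto
  finally show ?thesis .
qed

lemma alliance_count_eq:
  "alliance_count G k = card {S. S \<subseteq> pverts G \<and> conn_set (parcs G) S \<and> alliance_index G S = k}"
  unfolding alliance_count_def exact_defensive_alliance_def connected_in_iff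
  by (rule arg_cong[where f = card]) (auto simp: conn_set_def)

text \<open>At 1 the coefficients add up, which groups the connected sets by their index.\<close>

lemma poly_alliance_poly_1:
  "poly (alliance_poly G) 1 = int (card {S. S \<subseteq> pverts G \<and> conn_set (parcs G) S})"
proof -
  let ?C = "{S. S \<subseteq> pverts G \<and> conn_set (parcs G) S}"
  have fin: "finite ?C" using pair_finite_verts by (auto intro: finite_subset[of _ "Pow (pverts G)"])
  have "poly (alliance_poly G) 1 = (\<Sum>k\<in>alliance_range G. int (alliance_count G k))"
    by (simp add: alliance_poly_def poly_sum poly_monom)
  also have "\<dots> = (\<Sum>k\<in>alliance_range G. \<Sum>S\<in>{S \<in> ?C. alliance_index G S = k}. 1)"
    by (simp add: alliance_count_eq)
  also have "\<dots> = (\<Sum>S\<in>?C. 1)"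
  proof (rule sum.group[OF fin])
    show "finite (alliance_range G)" by (simp add: alliance_range_def)
    show "alliance_index G ` ?C \<subseteq> alliance_range G"
      unfolding conn_set_def
      by (rule image_subsetI, rule alliance_index_in_range) auto
  qed
  finally show ?thesis by simp
qed

end

text \<open>Transport along a bijection of \<open>A\<close> with \<open>B\<close>. It serves to
  match the contributions of the sets containing the dominating vertex in two graphs of equal
  order.\<close>

lemma card_Collect_subset_card_cong:
  assumes "finite A" "finite B" "card A = card B"
  shows "card {T. T \<subseteq> A \<and> P (card T)} = card {T. T \<subseteq> B \<and> P (card T)}"
proof -
  obtain h where h: "bij_betw h A B" using assms finite_same_card_bij by blast
  have inj: "card (h ` T) = card T" if "T \<subseteq> A" for T
    using h that by (meson bij_betw_def card_image inj_on_subset)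
  have "bij_betw ((`) h) (Pow A) (Pow B)" using h by (rule bij_betw_Pow)
  then have "bij_betw ((`) h) {T \<in> Pow A. P (card T)} {T \<in> Pow B. P (card T)}"
    by (rule bij_betw_Collect) (auto simp: inj)
  then show ?thesis by (auto dest: bij_betw_same_card)
qed

section \<open>Graphs with a dominating vertex\<close>

locale dominated_graph = pair_graph G for G :: "'a pair_pre_digraph" +
  fixes c :: 'a
  assumes c_vert: "c \<in> pverts G"
    and c_dom: "v \<in> pverts G \<Longrightarrow> v \<noteq> c \<Longrightarrow> (c, v) \<in> parcs G"
begin

abbreviation "R \<equiv> pverts G - {c}"

lemma finite_R [simp]: "finite R"
  using pair_finite_verts by auto

lemma card_pverts: "card (pverts G) = Suc (card R)"
  using c_vert pair_finite_verts by (metis card.remove)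

lemma sym_parcs: "sym (parcs G)"
  using arcs_symmetric by (auto intro: symI)

lemma nbrs_c: "parcs G `` {c} = R"
  using c_dom in_arcsD2 no_loops'[of c c] by auto

lemma conn_insert_c: "S \<subseteq> pverts G \<Longrightarrow> c \<in> S \<Longrightarrow> conn_set (parcs G) S"
  using conn_set_dominating[OF sym_parcs, of c S] c_dom by auto

lemma margin_c:
  assumes "S \<subseteq> pverts G" "c \<in> S"
  shows "margin G S c = 2 * int (card (S - {c})) - int (card R)"
proof -
  have "S \<inter> R = S - {c}" using assms by auto
  then show ?thesis using assms by (simp add: margin_eq nbrs_c)
qed

text \<open>Deleting \<open>c\<close> is a bijection onto subsets of \<open>R\<close>. Besides the
  plain count, \<open>P\<close> serves to prescribe the margin of \<open>c\<close>.\<close>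

lemma card_with_c:
  "card {S. S \<subseteq> pverts G \<and> c \<in> S \<and> P (card (S - {c}))} = card {T. T \<subseteq> R \<and> P (card T)}"
proof -
  have "bij_betw (\<lambda>S. S - {c}) {S. S \<subseteq> pverts G \<and> c \<in> S \<and> P (card (S - {c}))}
      {T. T \<subseteq> R \<and> P (card T)}"
    using c_vert
    by (intro bij_betw_byWitness[where f' = "insert c"]) (auto simp: insert_absorb subset_Diff_insert)
  then show ?thesis by (rule bij_betw_same_card)
qed

lemma card_connected_sets:
  "card {S. S \<subseteq> pverts G \<and> conn_set (parcs G) S} =
     2 ^ card R + card {T. T \<subseteq> R \<and> conn_set (parcs G) T}"
proof -
  have "{S. S \<subseteq> pverts G \<and> conn_set (parcs G) S} =
      {S. S \<subseteq> pverts G \<and> c \<in> S} \<union> {T. T \<subseteq> R \<and> conn_set (parcs G) T}"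
    using conn_insert_c by auto
  moreover have "card {S. S \<subseteq> pverts G \<and> c \<in> S} = 2 ^ card R"
    using card_with_c[of "\<lambda>_. True"] by (simp add: Pow_def[symmetric] card_Pow)
  moreover have "card ({S. S \<subseteq> pverts G \<and> c \<in> S} \<union> {T. T \<subseteq> R \<and> conn_set (parcs G) T}) =
      card {S. S \<subseteq> pverts G \<and> c \<in> S} + card {T. T \<subseteq> R \<and> conn_set (parcs G) T}"
    using pair_finite_verts
    by (intro card_Un_disjoint) (auto intro: finite_subset[of _ "Pow (pverts G)"])
  ultimately show ?thesis by simp
qed

text \<open>The empty set is a subset of \<open>R\<close> that is not connected. Strictness makes
  \<open>2 ^ card R\<close> the leading power of two in the number of all connected sets.\<close>

lemma card_connected_in_R_less: "card {T. T \<subseteq> R \<and> conn_set (parcs G) T} < 2 ^ card R"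
proof -
  have "{T. T \<subseteq> R \<and> conn_set (parcs G) T} \<subset> Pow R"
    by (auto simp: conn_set_def)
  then show ?thesis
    by (metis card_Pow finite_Pow_iff finite_R psubset_card_mono)
qed

text \<open>The degree bound concerns \<open>R\<close> only, so \<open>D\<close> may lie below the
  degree of \<open>c\<close>. The second summand depends only on \<open>card R\<close> and
  \<open>D\<close>; comparing two graphs of equal order thus compares their numbers of vertices of
  degree \<open>D\<close>.\<close>

lemma alliance_count_minus:
  assumes deg: "\<And>v. v \<in> R \<Longrightarrow> card (parcs G `` {v}) \<le> D"
  shows "alliance_count G (- int D) =
    card {v \<in> R. card (parcs G `` {v}) = D} +
    card {T. T \<subseteq> R \<and> 2 * int (card T) - int (card R) = - int D}"
proof -
  let ?X = "{v \<in> R. card (parcs G `` {v}) = D}"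
  let ?Y = "{S. S \<subseteq> pverts G \<and> c \<in> S \<and> 2 * int (card (S - {c})) - int (card R) = - int D}"
  \<comment> \<open>The neighbour \<open>c\<close> inside \<open>S\<close> lifts the margin of every
    other vertex at least two above the general lower bound \<open>- int D\<close>.\<close>
  have pos: "2 - int D \<le> margin G S v" if "S \<subseteq> pverts G" "c \<in> S" "v \<in> S" "v \<noteq> c" for S v
  proof -
    have "c \<in> S \<inter> parcs G `` {v}" using that c_dom[of v] arcs_symmetric by auto
    then have "card (S \<inter> parcs G `` {v}) > 0" by (subst card_gt_0_iff) auto
    moreover have "card (parcs G `` {v}) \<le> D" using deg[of v] that by auto
    ultimately show ?thesis using that by (simp add: margin_eq)
  qed
  have "{S. S \<subseteq> pverts G \<and> conn_set (parcs G) S \<and> alliance_index G S = - int D} =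
     (\<lambda>v. {v}) ` ?X \<union> ?Y" (is "?L = _")
  proof (intro set_eqI iffI)
    fix S assume "S \<in> ?L"
    then have S: "S \<subseteq> pverts G" "conn_set (parcs G) S" "S \<noteq> {}" "alliance_index G S = - int D"
      by (auto simp: conn_set_def)
    then obtain v where v: "v \<in> S" "margin G S v = - int D"
      using alliance_index_eq_iff by blast
    show "S \<in> (\<lambda>v. {v}) ` ?X \<union> ?Y"
    proof (cases "c \<in> S")
      case True
      then have "v = c" using pos[OF S(1) True v(1)] v by force
      then show ?thesis using S True v margin_c by auto
    next
      \<comment> \<open>Without \<open>c\<close>, equality forces both degree \<open>D\<close> and
        no neighbour in \<open>S\<close>, so connectedness leaves only \<open>v\<close>.\<close>
      case False
      then have "v \<in> R" using v S by auto
      then have "card (parcs G `` {v}) \<le> D" by (rule deg)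
      moreover have "2 * int (card (S \<inter> parcs G `` {v})) - int (card (parcs G `` {v})) = - int D"
        using v S by (simp add: margin_eq)
      ultimately have *: "card (parcs G `` {v}) = D" "card (S \<inter> parcs G `` {v}) = 0"
        by linarith+
      then have "parcs G `` {v} \<inter> S = {}" by (simp add: Int_commute)
      then have "S = {v}"
        using v by (intro conn_set_isolated[OF S(2)]) auto
      then show ?thesis using \<open>v \<in> R\<close> * by auto
    qed
  next
    fix S assume "S \<in> (\<lambda>v. {v}) ` ?X \<union> ?Y"
    then show "S \<in> ?L"
    proof
      assume "S \<in> (\<lambda>v. {v}) ` ?X"
      then obtain v where v: "S = {v}" "v \<in> ?X" by auto
      then have "{v} \<inter> parcs G `` {v} = {}" using no_loops' by auto
      then have "margin G {v} v = - int D" using v by (simp add: margin_eq)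
      then show ?thesis using v by (simp add: alliance_index_eq_iff)
    next
      assume S: "S \<in> ?Y"
      then have "margin G S c = - int D" using margin_c by auto
      moreover from this have "- int D \<le> margin G S v" if "v \<in> S" for v
        using pos[of S v] S that by (cases "v = c") auto
      ultimately have "alliance_index G S = - int D"
        using S by (subst alliance_index_eq_iff) auto
      then show ?thesis using S conn_insert_c by blast
    qed
  qed
  moreover have "card ((\<lambda>v. {v}) ` ?X \<union> ?Y) = card ?X + card ?Y"
    using pair_finite_verts
    by (subst card_Un_disjoint)
      (auto simp: card_image intro: finite_subset[of _ "Pow (pverts G)"])
  ultimately show ?thesis
    unfolding alliance_count_eq by (simp add: card_with_c[of "\<lambda>k. 2 * int k - int (card R) = - int D"])
qed

end
section \<open>Two-regular graphs\<close>

text \<open>Walk from \<open>v\<close> without turning back until a vertex repeats; the first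
  repetition is a return to \<open>v\<close>. Degrees are counted inside \<open>V\<close>, so
  \<open>r\<close> may have arcs leaving \<open>V\<close>, as happens when a dominating vertex is
  removed.\<close>

lemma two_regular_cycle:
  assumes V: "finite V" "v \<in> V"
    and loopfree: "\<And>u. (u, u) \<notin> r" and sym: "sym r"
    and reg: "\<And>u. u \<in> V \<Longrightarrow> card (V \<inter> r `` {u}) = 2"
  obtains p g where "3 \<le> p" "inj_on g {..<p}" "\<And>k. g k \<in> V" "g 0 = v" "\<And>k. g (k mod p) = g k"
    "\<And>k. V \<inter> r `` {g (Suc k)} = {g k, g (Suc (Suc k))}"
proof -
  have other: "\<exists>w'. V \<inter> r `` {w} = {u, w'} \<and> w' \<noteq> u" if "w \<in> V" "u \<in> V" "(u, w) \<in> r" for u w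
  proof -
    have "u \<in> V \<inter> r `` {w}" using that sym by (auto dest: symD)
    moreover obtain x y where "V \<inter> r `` {w} = {x, y}" "x \<noteq> y"
      using reg[OF \<open>w \<in> V\<close>] by (auto simp: card_2_iff)
    ultimately show ?thesis by (metis insertE insert_commute singletonD)
  qed
  have "V \<inter> r `` {v} \<noteq> {}" using reg[OF \<open>v \<in> V\<close>] by (metis card.empty zero_neq_numeral)
  then obtain w where w: "w \<in> V" "(v, w) \<in> r" by auto
  \<comment> \<open>The state of the walk is an arc inside \<open>V\<close>; \<open>Q\<close>
    continues it to the other neighbour of its head.\<close>
  define P where "P = (\<lambda>(a, b). a \<in> V \<and> b \<in> V \<and> (a, b) \<in> r)"
  define Q where "Q = (\<lambda>(a, b) (a', b'). a' = b \<and> V \<inter> r `` {b} = {a, b'} \<and> a \<noteq> b')"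
  have "\<exists>y. P y \<and> Q x y" if "P x" for x
  proof -
    obtain a b where x: "x = (a, b)" by fastforce
    then have "a \<in> V" "b \<in> V" "(a, b) \<in> r" using that by (auto simp: P_def)
    then obtain b' where b': "V \<inter> r `` {b} = {a, b'}" "b' \<noteq> a"
      using other[of b a] by auto
    then have "b' \<in> V" "(b, b') \<in> r" by blast+
    then have "P (b, b') \<and> Q x (b, b')" using b' that by (auto simp: P_def Q_def x)
    then show ?thesis by blast
  qed
  then obtain nx where nx: "\<And>x. P x \<Longrightarrow> P (nx x) \<and> Q x (nx x)" by metis
  define h where "h n = (nx ^^ n) (v, w)" for n
  have h: "h 0 = (v, w)" "P (h n)" "Q (h n) (h (Suc n))" for n
  proof -
    have "P (v, w)" using V w by (simp add: P_def)
    then show "P (h n)" using nx by (induction n) (auto simp: h_def)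
    then show "Q (h n) (h (Suc n))" using nx by (simp add: h_def)
  qed (simp add: h_def)
  define f where "f n = fst (h n)" for n
  have snd_h: "snd (h n) = f (Suc n)" for n
    using h(3)[of n] by (simp add: Q_def f_def case_prod_beta)
  have f0: "f 0 = v" by (simp add: f_def h)
  have f_in: "f n \<in> V" for n using h(2)[of n] by (simp add: P_def f_def case_prod_beta)
  have f_nbrs: "V \<inter> r `` {f (Suc n)} = {f n, f (Suc (Suc n))}"
    and f_skip: "f n \<noteq> f (Suc (Suc n))" for n
    using h(3)[of n] snd_h[of n] snd_h[of "Suc n"]
    by (simp_all add: Q_def f_def case_prod_beta)
  have f_arc: "(f n, f (Suc n)) \<in> r" for n
    using h(2)[of n] snd_h[of n] by (simp add: P_def f_def case_prod_beta)
  have f_step: "f n \<noteq> f (Suc n)" for n using f_arc[of n] loopfree by metis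
  have "\<exists>j. f j \<in> f ` {..<j}"
  proof (rule ccontr)
    assume *: "\<nexists>j. f j \<in> f ` {..<j}"
    have "inj f"
    proof (rule injI)
      fix i j assume "f i = f j"
      then show "i = j" using * by (metis imageI lessThan_iff linorder_neqE_nat)
    qed
    moreover have "finite (range f)" using V f_in by (auto intro: finite_subset)
    ultimately show False by (simp add: finite_image_iff)
  qed
  \<comment> \<open>\<open>p\<close> is the time of the first repetition, which exists because
    \<open>V\<close> is finite.\<close>
  then obtain p where p: "f p \<in> f ` {..<p}" and p_min: "\<And>j. j < p \<Longrightarrow> f j \<notin> f ` {..<j}"
    using exists_least_iff[of "\<lambda>j. f j \<in> f ` {..<j}"] by blast
  have inj: "inj_on f {..<p}"
  proof (rule inj_onI)
    fix i j assume "i \<in> {..<p}" "j \<in> {..<p}" "f i = f j"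
    then show "i = j" using p_min by (metis imageI lessThan_iff linorder_neqE_nat)
  qed
  obtain i where i: "i < p" "f p = f i" using p by auto
  \<comment> \<open>For \<open>i > 0\<close> both neighbours of \<open>f i\<close> are already
    known, so the vertex before \<open>f p\<close> would be \<open>f (i - 1)\<close> or
    \<open>f (i + 1)\<close>, against the minimality of \<open>p\<close> or the rule of not turning
    back.\<close>
  have "i = 0"
  proof (rule ccontr)
    assume "i \<noteq> 0"
    then obtain i' where i': "i = Suc i'" by (cases i) auto
    obtain p' where p': "p = Suc p'" using i by (cases p) auto
    have "f p' \<in> V \<inter> r `` {f i}"
      using f_nbrs[of p'] i p' by auto
    then have "f p' = f i' \<or> f p' = f (Suc i)"
      using f_nbrs[of i'] i' by auto
    then show False
    proof
      assume "f p' = f i'"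
      then show False using inj_onD[OF inj, of p' i'] i i' p' by auto
    next
      assume eq: "f p' = f (Suc i)"
      have "p' \<noteq> i" using f_step[of i] i p' by auto
      then have "p' = Suc i" using inj_onD[OF inj eq] i p' by auto
      then show False using f_skip[of i] i p' by auto
    qed
  qed
  then have fp: "f p = f 0" using i by simp
  have "p \<noteq> 1" "p \<noteq> 2" using fp f_step[of 0] f_skip[of 0] by (auto simp: numeral_2_eq_2)
  then have p3: "3 \<le> p" using i by auto
  \<comment> \<open>The walk gives the neighbours of \<open>f (Suc n)\<close> only; at the start,
    two distinct neighbours are exhibited and exhaust the degree.\<close>
  have nbrs0: "V \<inter> r `` {f 0} = {f (p - 1), f 1}"
  proof -
    have "f (p - 1) \<in> V \<inter> r `` {f 0}" using f_nbrs[of "p - 1"] fp p3 by auto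
    moreover have "f 1 \<in> V \<inter> r `` {f 0}" using f_arc[of 0] f_in by auto
    moreover have "f (p - 1) \<noteq> f 1" using inj_onD[OF inj, of "p - 1" 1] p3 by auto
    ultimately have "{f (p - 1), f 1} = V \<inter> r `` {f 0}"
      using reg[OF f_in[of 0]] V(1) by (intro card_seteq) auto
    then show ?thesis by simp
  qed
  \<comment> \<open>Repeating the first \<open>p\<close> values makes periodicity hold by
    construction, with no need to show it for \<open>f\<close>.\<close>
  define g where "g k = f (k mod p)" for k
  have g_lt: "g k = f k" if "k \<le> p" for k
    using that fp p3 by (cases "k = p") (auto simp: g_def)
  have "V \<inter> r `` {g (Suc k)} = {g k, g (Suc (Suc k))}" for k
  proof -
    define i where "i = k mod p"
    have i: "i < p" "g k = f i" "g (Suc k) = g (Suc i)" "g (Suc (Suc k)) = g (Suc (Suc i))"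
      using p3 by (auto simp: i_def g_def mod_Suc_eq mod_Suc_Suc_eq)
    show ?thesis
    proof (cases "Suc i < p")
      case True
      then show ?thesis using i f_nbrs[of i] g_lt by simp
    next
      case False
      then have "Suc i = p" using i by simp
      moreover from this have "p - 1 = i" by simp
      moreover have "g (Suc p) = f 1" using p3 by (simp add: g_def mod_Suc)
      ultimately have "g k = f (p - 1)" "g (Suc k) = f 0" "g (Suc (Suc k)) = f 1"
        using i fp g_lt[of p] by simp_all
      then show ?thesis using nbrs0 by simp
    qed
  qed
  moreover have "inj_on g {..<p}" using inj by (auto simp: inj_on_def g_def)
  ultimately show thesis
    using that[of p g] p3 f_in f0 by (simp add: g_def)
qed

text \<open>Unless \<open>T\<close> is closed under predecessors, and hence everything, it has a
  point whose predecessor is outside. The maximal run starting there is closed in \<open>T\<close>,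
  so it is all of \<open>T\<close>. Adding \<open>p - 1\<close> to an index plays the role of the
  predecessor.\<close>

lemma connected_subset_of_cycle:
  fixes g :: "nat \<Rightarrow> 'a"
  assumes per: "\<And>k. g (k mod p) = g k" and p: "0 < p"
    and nbrs: "\<And>k. V \<inter> r `` {g (Suc k)} = {g k, g (Suc (Suc k))}"
    and V: "range g \<subseteq> V"
    and T: "T \<subseteq> range g" "conn_set r T"
  shows "\<exists>s l. s < p \<and> l \<in> {1..p} \<and> T = g ` {s..<s + l}"
proof -
  have per_add: "g (k + p) = g k" for k by (metis mod_add_self2 per)
  have range_g: "range g = g ` {..<p}"
    using per p by (metis (no_types, lifting) image_subset_iff imageI lessThan_iff
        mod_less_divisor subset_antisym subset_UNIV image_mono)
  show ?thesis
  proof (cases "\<forall>k. g (Suc k) \<in> T \<longrightarrow> g k \<in> T")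
    case True
    have down: "g k \<in> T" if "g (k + j) \<in> T" for k j
      using that True by (induction j) auto
    obtain k0 where k0: "g k0 \<in> T" using T by (auto simp: conn_set_def)
    have "g k \<in> T" for k
    proof -
      \<comment> \<open>Adding enough periods to \<open>k0\<close> puts the given \<open>k\<close>
        below it, so that \<open>down\<close> reaches \<open>k\<close>.\<close>
      have "g (k0 + k * p) = g k0" by (metis mod_mult_self1 per)
      moreover have "k \<le> k0 + k * p" using p by (simp add: trans_le_add2)
      ultimately show ?thesis using down[of k "k0 + k * p - k"] k0 by auto
    qed
    then have "T = g ` {0..<0 + p}" using T range_g by (auto simp: atLeast0LessThan)
    then show ?thesis using p by (intro exI[of _ 0] exI[of _ p]) auto
  next
    case False
    then obtain k where k: "g (Suc k) \<in> T" "g k \<notin> T" by auto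
    define s where "s = Suc k mod p"
    have s: "s < p" "g s \<in> T" "g (s + (p - 1)) \<notin> T"
    proof -
      have "g (s + (p - 1)) = g ((Suc k + (p - 1)) mod p)"
        unfolding s_def by (metis mod_add_left_eq per)
      also have "\<dots> = g k" using p per per_add[of k] by simp
      finally show "g (s + (p - 1)) \<notin> T" using k by simp
    qed (use k p per in \<open>auto simp: s_def\<close>)
    define l where "l = (LEAST l. g (s + l) \<notin> T)"
    have l: "g (s + l) \<notin> T" unfolding l_def using s(3) by (rule LeastI)
    have l_min: "g (s + j) \<in> T" if "j < l" for j
      using not_less_Least[of j "\<lambda>l. g (s + l) \<notin> T"] that by (simp add: l_def)
    have "l \<noteq> 0" using l s(2) by (metis add_0_right)
    \<comment> \<open>The predecessor of \<open>g s\<close> is outside \<open>T\<close>, so the run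
      stops before a full turn.\<close>
    have "l \<le> p - 1" unfolding l_def using s(3) by (rule Least_le)
    let ?A = "g ` {s..<s + l}"
    have "?A = T"
    proof (rule conn_setD[OF T(2)])
      show "?A \<subseteq> T"
      proof
        fix x assume "x \<in> ?A"
        then obtain j where "x = g j" "s \<le> j" "j < s + l" by auto
        then show "x \<in> T" using l_min[of "j - s"] by auto
      qed
      show "?A \<noteq> {}" using \<open>l \<noteq> 0\<close> by auto
      show "r `` ?A \<inter> T \<subseteq> ?A"
      proof
        fix y assume "y \<in> r `` ?A \<inter> T"
        then obtain j where j: "s \<le> j" "j < s + l" "(g j, y) \<in> r" "y \<in> T" by auto
        \<comment> \<open>\<open>nbrs\<close> speaks of successors, hence \<open>g j\<close> is
          written as \<open>g (j + p)\<close>.\<close>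
        have "y \<in> V \<inter> r `` {g (Suc (j + (p - 1)))}"
          using j T V per_add[of j] p by auto
        then have "y = g (j + (p - 1)) \<or> y = g (Suc j)"
          using nbrs[of "j + (p - 1)"] per_add[of "Suc j"] p by auto
        then show "y \<in> ?A"
        proof
          assume y: "y = g (Suc j)"
          then have "Suc j \<noteq> s + l" using j l by auto
          then show ?thesis using j y by auto
        next
          assume y: "y = g (j + (p - 1))"
          then have "j \<noteq> s" using j s by auto
          then have "j + (p - 1) = (j - 1) + p" using j p by auto
          then have "y = g (j - 1)" using y per_add by simp
          moreover have "j - 1 \<in> {s..<s + l}" using j \<open>j \<noteq> s\<close> by auto
          ultimately show ?thesis by blast
        qed
      qed
    qed
    then show ?thesis
      using \<open>l \<noteq> 0\<close> \<open>l \<le> p - 1\<close> s by (intro exI[of _ s] exI[of _ l]) auto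
  qed
qed

section \<open>Counting connected sets in unions of cycles\<close>

lemma card_connected_subsets_cycle:
  assumes "\<And>k. g (k mod p) = g k" "0 < p"
    and "\<And>k. V \<inter> r `` {g (Suc k)} = {g k, g (Suc (Suc k))}"
    and "range g \<subseteq> V"
  shows "card {T. T \<subseteq> range g \<and> conn_set r T} \<le> p\<^sup>2"
proof -
  have "{T. T \<subseteq> range g \<and> conn_set r T} \<subseteq> (\<lambda>(s, l). g ` {s..<s + l}) ` ({..<p} \<times> {1..p})"
  proof
    fix T assume "T \<in> {T. T \<subseteq> range g \<and> conn_set r T}"
    then obtain s l where "s < p" "l \<in> {1..p}" "T = g ` {s..<s + l}"
      using connected_subset_of_cycle[OF assms, of T] by blast
    then show "T \<in> (\<lambda>(s, l). g ` {s..<s + l}) ` ({..<p} \<times> {1..p})"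
      by (intro image_eqI[of _ _ "(s, l)"]) auto
  qed
  then have "card {T. T \<subseteq> range g \<and> conn_set r T} \<le> card ({..<p} \<times> {1..p})"
    by (intro surj_card_le) auto
  then show ?thesis by (simp add: power2_eq_square)
qed

text \<open>If \<open>T\<close> meets \<open>K\<close>, then \<open>T \<inter> K\<close> is closed
  in \<open>T\<close> and therefore equals \<open>T\<close>.\<close>

lemma conn_set_closed_cases:
  assumes "conn_set r T" "T \<subseteq> V" "r `` K \<inter> V \<subseteq> K"
  shows "T \<subseteq> K \<or> T \<subseteq> V - K"
proof (cases "T \<inter> K = {}")
  case False
  then have "T \<inter> K = T" using assms by (intro conn_setD[OF assms(1)]) auto
  then show ?thesis by auto
qed (use assms in auto)

lemma card_connected_subsets_split:
  assumes "finite V" "K \<subseteq> V" "r `` K \<inter> V \<subseteq> K"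
  shows "card {T. T \<subseteq> V \<and> conn_set r T} \<le>
    card {T. T \<subseteq> K \<and> conn_set r T} + card {T. T \<subseteq> V - K \<and> conn_set r T}"
proof -
  have "finite (Pow V)" using assms by simp
  then have "card {T. T \<subseteq> V \<and> conn_set r T} \<le>
      card ({T. T \<subseteq> K \<and> conn_set r T} \<union> {T. T \<subseteq> V - K \<and> conn_set r T})"
  proof (intro card_mono)
    show "finite ({T. T \<subseteq> K \<and> conn_set r T} \<union> {T. T \<subseteq> V - K \<and> conn_set r T})"
      using assms(2) by (intro finite_subset[OF _ \<open>finite (Pow V)\<close>]) auto
    show "{T. T \<subseteq> V \<and> conn_set r T} \<subseteq>
        {T. T \<subseteq> K \<and> conn_set r T} \<union> {T. T \<subseteq> V - K \<and> conn_set r T}"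
      using conn_set_closed_cases[OF _ _ assms(3)] by blast
  qed
  also have "\<dots> \<le> card {T. T \<subseteq> K \<and> conn_set r T} + card {T. T \<subseteq> V - K \<and> conn_set r T}"
    by (rule card_Un_le)
  finally show ?thesis .
qed

text \<open>Strong induction, splitting off one cycle of length \<open>p\<close>. If
  \<open>q\<close> vertices remain, then \<open>p\<^sup>2 + q\<^sup>2\<close> falls short of
  \<open>(p + q)\<^sup>2\<close> by \<open>2 * p * q\<close>, which is at least
  \<open>p + q\<close>. The first alternative is that \<open>V\<close> is a single cycle.\<close>

lemma card_connected_subsets_two_regular:
  assumes "finite V" "\<And>u. (u, u) \<notin> r" "sym r"
    and "\<And>u. u \<in> V \<Longrightarrow> card (V \<inter> r `` {u}) = 2"
  shows "card {T. T \<subseteq> V \<and> conn_set r T} \<le> (card V)\<^sup>2 \<and>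
    ((\<exists>g. inj_on g {..<card V} \<and> g ` {..<card V} = V \<and> (\<forall>k. g (k mod card V) = g k) \<and>
        (\<forall>k. V \<inter> r `` {g (Suc k)} = {g k, g (Suc (Suc k))})) \<or>
      card {T. T \<subseteq> V \<and> conn_set r T} + card V \<le> (card V)\<^sup>2)"
  using assms
proof (induction "card V" arbitrary: V rule: less_induct)
  case less
  show ?case
  proof (cases "V = {}")
    case True
    then show ?thesis by (auto simp: conn_set_def)
  next
    case False
    then obtain v where "v \<in> V" by auto
    then obtain p g where g: "3 \<le> p" "inj_on g {..<p}" "\<And>k. g k \<in> V" "\<And>k. g (k mod p) = g k"
      "\<And>k. V \<inter> r `` {g (Suc k)} = {g k, g (Suc (Suc k))}"
      using two_regular_cycle[of V v r] less.prems by metis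
    have "range g = g ` {..<p}"
    proof -
      have "g k \<in> g ` {..<p}" for k
        using g(1,4) by (metis imageI lessThan_iff mod_less_divisor not_numeral_le_zero zero_less_iff_neq_zero)
      then show ?thesis by auto
    qed
    define K where "K = range g"
    have card_K: "card K = p"
      using \<open>range g = _\<close> g(2) by (simp add: K_def card_image)
    have K: "K \<subseteq> V" using g by (auto simp: K_def)
    have "r `` {g k} \<inter> V \<subseteq> K" for k
    proof -
      have "g k = g (Suc (k + (p - 1)))" using g(4)[of "k + p"] g(1,4) by (simp add: g(4))
      then show ?thesis using g(5)[of "k + (p - 1)"] by (auto simp: K_def)
    qed
    then have closed: "r `` K \<inter> V \<subseteq> K" by (auto simp: K_def)
    have cyc: "card {T. T \<subseteq> K \<and> conn_set r T} \<le> p\<^sup>2"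
      unfolding K_def using g by (intro card_connected_subsets_cycle[of g p V r]) auto
    have card_V: "card V = p + card (V - K)"
      using card_K K less.prems(1) by (metis card_Diff_subset card_mono finite_subset le_add_diff_inverse)
    have reg: "card ((V - K) \<inter> r `` {u}) = 2" if "u \<in> V - K" for u
    proof -
      \<comment> \<open>By symmetry no arc enters the closed set \<open>K\<close> from outside, so
        the rest is two-regular again.\<close>
      have "V \<inter> r `` {u} \<subseteq> V - K"
        using closed that less.prems(3) by (auto dest: symD)
      then have "(V - K) \<inter> r `` {u} = V \<inter> r `` {u}" by auto
      then show ?thesis using less.prems(4)[of u] that by simp
    qed
    have IH: "card {T. T \<subseteq> V - K \<and> conn_set r T} \<le> (card (V - K))\<^sup>2"
      using less.hyps[of "V - K"] less.prems reg card_V g(1) by auto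
    note split = card_connected_subsets_split[OF less.prems(1) K closed]
    show ?thesis
    proof (cases "V - K = {}")
      case True
      then have "V = K" using K by auto
      then have "card V = p" "g ` {..<p} = V"
        using card_K \<open>range g = _\<close> by (auto simp: K_def)
      then have "\<exists>g. inj_on g {..<card V} \<and> g ` {..<card V} = V \<and> (\<forall>k. g (k mod card V) = g k) \<and>
        (\<forall>k. V \<inter> r `` {g (Suc k)} = {g k, g (Suc (Suc k))})"
        using g(2,4,5) by (intro exI[of _ g]) simp
      then show ?thesis using cyc \<open>V = K\<close> card_K by simp
    next
      case False
      then have "3 \<le> card (V - K)"
      proof -
        obtain u where u: "u \<in> V - K" using False by auto
        have "finite (V - K)" using less.prems by simp
        moreover have "(V - K) \<inter> r `` {u} \<subseteq> (V - K) - {u}" using less.prems(2) by auto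
        ultimately have "2 \<le> card ((V - K) - {u})"
          using reg[OF u] by (metis card_mono finite_Diff)
        then show ?thesis using u \<open>finite (V - K)\<close> by (simp add: card_Diff_singleton)
      qed
      then have "p \<le> p * card (V - K)" "card (V - K) \<le> p * card (V - K)"
        using g(1) by simp_all
      moreover have "(card V)\<^sup>2 = p\<^sup>2 + (card (V - K))\<^sup>2 + p * card (V - K) + p * card (V - K)"
        using card_V by (simp add: power2_eq_square algebra_simps)
      ultimately have "card {T. T \<subseteq> V \<and> conn_set r T} + card V \<le> (card V)\<^sup>2"
        using split cyc IH card_V by linarith
      then show ?thesis by simp
    qed
  qed
qed

section \<open>Wheels\<close>

lemma pverts_wheel: "pverts (wheel_graph n) = insert (Inl ()) (Inr ` {..<n - 1})"
  by (auto simp: wheel_graph_def graph_join_def single_vertex_graph_def cycle_graph_def)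

lemma parcs_wheel:
  "(Inl (), Inl ()) \<notin> parcs (wheel_graph n)"
  "(Inl (), Inr i) \<in> parcs (wheel_graph n) \<longleftrightarrow> i < n - 1"
  "(Inr i, Inl ()) \<in> parcs (wheel_graph n) \<longleftrightarrow> i < n - 1"
  "(Inr i, Inr j) \<in> parcs (wheel_graph n) \<longleftrightarrow>
     i < n - 1 \<and> j < n - 1 \<and> (j = Suc i mod (n - 1) \<or> i = Suc j mod (n - 1))"
  by (auto simp: wheel_graph_def graph_join_def single_vertex_graph_def cycle_graph_def)

text \<open>Adding \<open>m - 1\<close> inverts \<open>Suc\<close> modulo \<open>m\<close>; this
  turns the symmetric adjacency condition of the rim into two explicit neighbours.\<close>

lemma eq_Suc_mod_iff:
  assumes "i < m" "j < m"
  shows "i = Suc j mod m \<longleftrightarrow> j = (i + (m - 1)) mod m"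
proof
  assume "i = Suc j mod m"
  then have "(i + (m - 1)) mod m = (Suc j + (m - 1)) mod m" by (simp add: mod_add_left_eq)
  then show "j = (i + (m - 1)) mod m" using assms by simp
next
  assume "j = (i + (m - 1)) mod m"
  then have "Suc j mod m = Suc (i + (m - 1)) mod m" by (simp add: mod_Suc_eq)
  then show "i = Suc j mod m" using assms by simp
qed

text \<open>For \<open>m = 2\<close> predecessor and successor coincide; \<open>3 \<le> m\<close>,
  that is \<open>n \<ge> 4\<close> for wheels, excludes such degenerate rims.\<close>

lemma mod_neighbours_distinct:
  assumes "i < m" "3 \<le> m"
  shows "(i + (m - 1)) mod m \<noteq> Suc i mod m" "Suc i mod m \<noteq> i" "(i + (m - 1)) mod m \<noteq> i"
proof -
  have *: "(i + (m - 1)) mod m = (if i = 0 then m - 1 else i - 1)"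
    using assms by (auto simp: mod_if)
  show "(i + (m - 1)) mod m \<noteq> Suc i mod m" "Suc i mod m \<noteq> i" "(i + (m - 1)) mod m \<noteq> i"
    unfolding * using assms by (auto simp: mod_Suc)
qed

lemma dominated_graph_wheel:
  assumes "n \<ge> 4"
  shows "dominated_graph (wheel_graph n) (Inl ())"
proof unfold_locales
  let ?W = "wheel_graph n"
  have cases: "x = Inl () \<or> (\<exists>i. x = Inr i)" for x :: "unit + nat" by (cases x) auto
  have in_verts: "u \<in> pverts ?W \<and> v \<in> pverts ?W" if "(u, v) \<in> parcs ?W" for u v
    using that cases[of u] cases[of v] by (auto simp: pverts_wheel parcs_wheel)
  show "e \<in> parcs ?W \<Longrightarrow> fst e \<in> pverts ?W" "e \<in> parcs ?W \<Longrightarrow> snd e \<in> pverts ?W" for e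
    using in_verts[of "fst e" "snd e"] by auto
  show "finite (pverts ?W)" by (simp add: pverts_wheel)
  then have "finite (pverts ?W \<times> pverts ?W)" by simp
  moreover have "parcs ?W \<subseteq> pverts ?W \<times> pverts ?W"
    by (rule subrelI, drule in_verts) simp
  ultimately show "finite (parcs ?W)" by (rule finite_subset[rotated])
  show "fst e \<noteq> snd e" if "e \<in> parcs ?W" for e
  proof -
    obtain u v where e: "e = (u, v)" by fastforce
    have "Suc i mod (n - 1) \<noteq> i" "i \<noteq> Suc i mod (n - 1)" if "i < n - 1" for i
    proof -
      have "3 \<le> n - 1" using assms by simp
      then show "Suc i mod (n - 1) \<noteq> i" by (rule mod_neighbours_distinct(2)[OF that])
      then show "i \<noteq> Suc i mod (n - 1)" by (rule not_sym)
    qed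
    then show ?thesis using that cases[of u] cases[of v] by (auto simp: e parcs_wheel)
  qed
  have "(v, u) \<in> parcs ?W" if "(u, v) \<in> parcs ?W" for u v
    using that cases[of u] cases[of v] by (auto simp: parcs_wheel)
  then show "symmetric (with_proj ?W)" by (auto simp: symmetric_def intro: symI)
  show "Inl () \<in> pverts ?W" by (simp add: pverts_wheel)
  show "(Inl (), v) \<in> parcs ?W" if "v \<in> pverts ?W" "v \<noteq> Inl ()" for v
    using that by (auto simp: pverts_wheel parcs_wheel)
qed

lemma degree_wheel_rim:
  assumes "n \<ge> 4" "i < n - 1"
  shows "card (parcs (wheel_graph n) `` {Inr i}) = 3"
proof -
  let ?m = "n - 1"
  have "parcs (wheel_graph n) `` {Inr i} = {Inl (), Inr (Suc i mod ?m), Inr ((i + (?m - 1)) mod ?m)}"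
    (is "?L = ?R")
  proof (intro set_eqI)
    fix x :: "unit + nat"
    show "x \<in> ?L \<longleftrightarrow> x \<in> ?R"
    proof (cases x)
      case (Inr j)
      have "x \<in> ?L \<longleftrightarrow> j < ?m \<and> (j = Suc i mod ?m \<or> j = (i + (?m - 1)) mod ?m)"
        using assms eq_Suc_mod_iff[of i ?m j] by (auto simp: Inr parcs_wheel)
      then show ?thesis using assms by (auto simp: Inr)
    qed (use assms in \<open>simp add: parcs_wheel\<close>)
  qed
  moreover have "Suc i mod ?m \<noteq> (i + (?m - 1)) mod ?m"
  proof (rule not_sym, rule mod_neighbours_distinct(1))
    show "i < ?m" "3 \<le> ?m" using assms by linarith+
  qed
  ultimately show ?thesis by simp
qed

section \<open>Cyclic intervals of the rim\<close>

definition rim_arc :: "nat \<Rightarrow> nat \<times> nat \<Rightarrow> nat set" where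
  "rim_arc m = (\<lambda>(i, j). {k. k < m \<and> (if i \<le> j then i \<le> k \<and> k \<le> j else k \<le> j \<or> i \<le> k)})"

text \<open>The walk from \<open>i\<close> upwards to \<open>j\<close>, wrapping through
  \<open>m - 1\<close> and \<open>0\<close> when \<open>j < i\<close>, is unrolled to an interval of
  naturals, so that \<open>conn_set_path\<close> applies.\<close>

lemma rim_arc_eq_image:
  assumes "i < m" "j < m"
  shows "rim_arc m (i, j) = (\<lambda>k. k mod m) ` {i..(if i \<le> j then j else j + m)}"
proof (intro equalityI subsetI)
  fix k assume k: "k \<in> rim_arc m (i, j)"
  show "k \<in> (\<lambda>k. k mod m) ` {i..(if i \<le> j then j else j + m)}"
  proof (cases "i \<le> k")
    case True
    then show ?thesis
      using k assms by (intro image_eqI[of _ _ k]) (auto simp: rim_arc_def split: if_splits)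
  next
    case False
    then show ?thesis
      using k assms by (intro image_eqI[of _ _ "k + m"]) (auto simp: rim_arc_def split: if_splits)
  qed
next
  fix k assume "k \<in> (\<lambda>k. k mod m) ` {i..(if i \<le> j then j else j + m)}"
  then obtain l where l: "k = l mod m" "i \<le> l" "l \<le> (if i \<le> j then j else j + m)" by auto
  show "k \<in> rim_arc m (i, j)"
  proof (cases "l < m")
    case True
    then show ?thesis using l by (auto simp: rim_arc_def)
  next
    case False
    then have "j < i" "l \<le> j + m" using l assms by (auto split: if_splits)
    then have "k = l - m" using l(1) False assms by (simp add: le_mod_geq)
    then show ?thesis using \<open>j < i\<close> \<open>l \<le> j + m\<close> False assms by (auto simp: rim_arc_def)
  qed
qed

text \<open>A pair with \<open>i = Suc j\<close> yields the whole rim, which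
  \<open>(0, m - 1)\<close> already represents; hence the exclusion. Arcs without wrapping are
  determined as intervals, wrapping ones by their complementary gaps.\<close>

lemma inj_on_rim_arc: "inj_on (rim_arc m) {(i, j). i < m \<and> j < m \<and> i \<noteq> Suc j}"
proof -
  have mixed: False
    if "i \<le> j" "j < m" "Suc j' < i'" "i' < m" "rim_arc m (i, j) = rim_arc m (i', j')" for i j i' j'
  proof -
    \<comment> \<open>A wrapping arc contains both \<open>0\<close> and \<open>m - 1\<close> but
      misses a vertex; an arc without wrapping that contains both misses none.\<close>
    have "0 \<in> rim_arc m (i', j')" "m - 1 \<in> rim_arc m (i', j')" "Suc j' \<notin> rim_arc m (i', j')"
      using that(1-4) by (auto simp: rim_arc_def)
    then have "0 \<in> rim_arc m (i, j)" "m - 1 \<in> rim_arc m (i, j)" "Suc j' \<notin> rim_arc m (i, j)"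
      using that(5) by simp_all
    then show False using that(1-4) by (auto simp: rim_arc_def)
  qed
  have plain: "i = i' \<and> j = j'"
    if "i \<le> j" "j < m" "i' \<le> j'" "j' < m" "rim_arc m (i, j) = rim_arc m (i', j')" for i j i' j'
  proof -
    have arcs: "rim_arc m (i, j) = {i..j}" "rim_arc m (i', j') = {i'..j'}"
      using that(1-4) by (auto simp: rim_arc_def)
    have "{i..j} = {i'..j'}" using that(5) unfolding arcs .
    then show ?thesis using that(1) by simp
  qed
  have wrap: "i = i' \<and> j = j'"
    if "Suc j < i" "i < m" "Suc j' < i'" "i' < m" "rim_arc m (i, j) = rim_arc m (i', j')" for i j i' j'
  proof -
    have gaps: "{Suc j..<i} = {..<m} - rim_arc m (i, j)" "{Suc j'..<i'} = {..<m} - rim_arc m (i', j')"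
      using that(1-4) by (auto simp: rim_arc_def)
    have "{Suc j..<i} = {Suc j'..<i'}" unfolding gaps that(5) ..
    then show ?thesis using that(1-4) atLeastLessThan_inj[of "Suc j" i "Suc j'" i'] by simp
  qed
  show ?thesis
  proof (rule inj_onI, clarify)
    fix i j i' j'
    assume *: "i < m" "j < m" "i \<noteq> Suc j" "i' < m" "j' < m" "i' \<noteq> Suc j'"
      and eq: "rim_arc m (i, j) = rim_arc m (i', j')"
    consider "i \<le> j" "i' \<le> j'" | "i \<le> j" "Suc j' < i'" | "Suc j < i" "i' \<le> j'"
      | "Suc j < i" "Suc j' < i'" using * by linarith
    then show "i = i' \<and> j = j'"
    proof cases
      case 1
      then show ?thesis using * eq by (intro plain)
    next
      case 2
      then have False using * eq by (intro mixed[of i j j' i'])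
      then show ?thesis ..
    next
      case 3
      then have False using * eq[symmetric] by (intro mixed[of i' j' j i])
      then show ?thesis ..
    next
      case 4
      then show ?thesis using * eq by (intro wrap)
    qed
  qed
qed

text \<open>The excluded pairs are \<open>(Suc j, j)\<close> for \<open>j < m - 1\<close>. The
  additive form avoids truncated subtraction.\<close>

lemma card_rim_arcs:
  assumes "0 < m"
  shows "card {(i, j). i < m \<and> j < m \<and> i \<noteq> Suc j} + m = Suc (m\<^sup>2)"
proof -
  let ?I = "{(i, j). i < m \<and> j < m \<and> i \<noteq> Suc j}"
  have "{..<m} \<times> {..<m} = ?I \<union> (\<lambda>j. (Suc j, j)) ` {..<m - 1}" by auto
  moreover have "card (?I \<union> (\<lambda>j. (Suc j, j)) ` {..<m - 1}) =
      card ?I + card ((\<lambda>j. (Suc j, j)) ` {..<m - 1})"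
    by (intro card_Un_disjoint) (auto intro: finite_subset[of _ "{..<m} \<times> {..<m}"])
  moreover have "card ((\<lambda>j. (Suc j, j)) ` {..<m - 1}) = m - 1"
    by (simp add: card_image inj_on_def)
  moreover have "card ({..<m} \<times> {..<m}) = m\<^sup>2" by (simp add: power2_eq_square)
  ultimately show ?thesis using assms by simp
qed

text \<open>The cyclic intervals alone give \<open>m\<^sup>2 - m + 1\<close> connected sets for
  \<open>m = n - 1\<close>, one more than the bound in the second alternative of
  \<open>card_connected_subsets_two_regular\<close>.\<close>

lemma card_connected_rim:
  assumes "n \<ge> 4"
  shows "(n - 1)\<^sup>2 <
    card {T. T \<subseteq> Inr ` {..<n - 1} \<and> conn_set (parcs (wheel_graph n)) T} + (n - 1)"
proof -
  let ?m = "n - 1" and ?C = "{T. T \<subseteq> Inr ` {..<n - 1} \<and> conn_set (parcs (wheel_graph n)) T}"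
  let ?I = "{(i, j). i < ?m \<and> j < ?m \<and> i \<noteq> Suc j}"
  let ?f = "\<lambda>x. (Inr :: nat \<Rightarrow> unit + nat) ` rim_arc ?m x"
  interpret W: dominated_graph "wheel_graph n" "Inl ()"
    using assms by (rule dominated_graph_wheel)
  have "Inr ` rim_arc ?m (i, j) \<in> ?C" if "i < ?m" "j < ?m" for i j
  proof -
    have img: "Inr ` rim_arc ?m (i, j) =
        (\<lambda>k. Inr (k mod ?m)) ` {i..(if i \<le> j then j else j + ?m)}"
      unfolding rim_arc_eq_image[OF that] image_image ..
    have "conn_set (parcs (wheel_graph n)) (Inr ` rim_arc ?m (i, j))"
      unfolding img using that assms by (intro conn_set_path W.sym_parcs) (auto simp: parcs_wheel mod_Suc_eq)
    moreover have "Inr ` rim_arc ?m (i, j) \<subseteq> Inr ` {..<?m}" by (auto simp: rim_arc_def)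
    ultimately show ?thesis by simp
  qed
  then have "?f ` ?I \<subseteq> ?C" by blast
  moreover have "finite ?C" by (rule finite_subset[of _ "Pow (Inr ` {..<n - 1})"]) auto
  ultimately have "card (?f ` ?I) \<le> card ?C" by (rule card_mono[rotated])
  moreover have "inj_on ?f ?I"
  proof (rule inj_onI)
    fix x y assume "x \<in> ?I" "y \<in> ?I" "?f x = ?f y"
    moreover from this have "rim_arc ?m x = rim_arc ?m y"
      by (simp only: inj_image_eq_iff[OF inj_Inr])
    ultimately show "x = y" using inj_onD[OF inj_on_rim_arc] by blast
  qed
  ultimately have "card ?I \<le> card ?C" by (simp add: card_image)
  then show ?thesis using card_rim_arcs[of ?m] assms by linarith
qed

text \<open>Arcs are pairs of vertices, so a vertex bijection that preserves and reflects adjacency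
  induces the arc map \<open>map_prod h h\<close>.\<close>

lemma digraph_isoI:
  assumes "pair_wf_digraph G" "pair_wf_digraph H" "bij_betw h (pverts G) (pverts H)"
    and "\<And>u v. u \<in> pverts G \<Longrightarrow> v \<in> pverts G \<Longrightarrow>
      (u, v) \<in> parcs G \<longleftrightarrow> (h u, h v) \<in> parcs H"
  shows "digraph_iso (with_proj G) (with_proj H)"
proof -
  interpret G: pair_wf_digraph G by fact
  interpret H: pair_wf_digraph H by fact
  have inj: "inj_on h (pverts G)" and img: "h ` pverts G = pverts H"
    using assms(3) by (auto simp: bij_betw_def)
  define f where "f = \<lparr>iso_verts = h, iso_arcs = map_prod h h, iso_head = snd, iso_tail = fst\<rparr>"
  have "parcs G \<subseteq> pverts G \<times> pverts G"
    by (auto dest: G.in_arcsD1 G.in_arcsD2)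
  then have "inj_on (map_prod h h) (parcs G)"
    using map_prod_inj_on[OF inj inj] inj_on_subset by blast
  then have "pre_digraph.digraph_isomorphism (with_proj G) f"
    using inj G.wf_digraph_axioms by (simp add: pre_digraph.digraph_isomorphism_def f_def)
  moreover have "map_prod h h ` parcs G = parcs H"
  proof (intro equalityI subsetI)
    fix e assume "e \<in> parcs H"
    then have "fst e \<in> h ` pverts G" "snd e \<in> h ` pverts G"
      unfolding img by (rule H.arc_fst_in_verts H.arc_snd_in_verts)+
    then obtain u v where uv: "u \<in> pverts G" "v \<in> pverts G" "fst e = h u" "snd e = h v"
      by (elim imageE)
    then have e: "e = map_prod h h (u, v)" by (simp add: prod_eq_iff)
    then have "(u, v) \<in> parcs G" using assms(4)[OF uv(1,2)] \<open>e \<in> parcs H\<close> by simp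
    then show "e \<in> map_prod h h ` parcs G" using e by (rule image_eqI[rotated])
  next
    fix e assume "e \<in> map_prod h h ` parcs G"
    then obtain u v where uv: "(u, v) \<in> parcs G" "e = (h u, h v)" by auto
    then show "e \<in> parcs H"
      using assms(4)[of u v] G.in_arcsD1[of u v] G.in_arcsD2[of u v] by simp
  qed
  then have "with_proj H = app_iso f (with_proj G)"
    by (simp add: app_iso_def f_def with_proj_def img)
  ultimately show ?thesis unfolding digraph_iso_def by blast
qed

section \<open>The characterization\<close>

text \<open>A margin is at least minus the degree. The value one minus the order therefore forces a
  vertex adjacent to all others.\<close>

lemma (in pair_graph) dominating_vertex:
  assumes "alliance_count G (1 - int (card (pverts G))) \<noteq> 0"
  shows "\<exists>c. dominated_graph G c"
proof -
  have "{S. S \<subseteq> pverts G \<and> conn_set (parcs G) S \<and> alliance_index G S = 1 - int (card (pverts G))} \<noteq> {}"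
    using assms unfolding alliance_count_eq by (metis card.empty)
  then obtain S where S: "S \<subseteq> pverts G" "S \<noteq> {}" "alliance_index G S = 1 - int (card (pverts G))"
    by (auto simp: conn_set_def)
  then obtain v where v: "v \<in> S" "margin G S v = 1 - int (card (pverts G))"
    using alliance_index_eq_iff by blast
  have vV: "v \<in> pverts G" using v S by auto
  have sub: "parcs G `` {v} \<subseteq> pverts G - {v}" using in_arcsD2 no_loops'[of v v] by auto
  have "card (pverts G) \<le> Suc (card (parcs G `` {v}))"
    using v S by (simp add: margin_eq)
  then have "parcs G `` {v} = pverts G - {v}"
    using sub vV pair_finite_verts by (intro card_seteq) auto
  then have "dominated_graph G v" using vV by unfold_locales auto
  then show ?thesis by blast
qed

text \<open>The total lies in the interval from \<open>2 ^ a\<close> up to, but excluding,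
  \<open>2 ^ Suc a\<close>, and such intervals are disjoint for distinct exponents.\<close>

lemma power2_decomposition_unique:
  fixes a b x y :: nat
  assumes "2 ^ a + x = 2 ^ b + y" "x < 2 ^ a" "y < 2 ^ b"
  shows "a = b"
proof -
  have False if "a' < b'" "2 ^ a' + x' = 2 ^ b' + y'" "x' < 2 ^ a'" for a' b' x' y' :: nat
  proof -
    have "(2::nat) ^ Suc a' \<le> 2 ^ b'" using that by (intro power_increasing) auto
    then show False using that by simp
  qed
  then show ?thesis using assms by (metis linorder_neqE_nat)
qed

text \<open>Downward induction on a degree bound for \<open>G\<close>, from the trivial bound
  \<open>card (pverts G - {c})\<close> to \<open>r\<close>.\<close>

lemma degrees_eq_of_alliance_counts:
  assumes "dominated_graph G c" "dominated_graph H d"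
    and card: "card (pverts G - {c}) = card (pverts H - {d})"
    and counts: "\<And>D. D \<le> card (pverts G - {c}) \<Longrightarrow>
      alliance_count G (- int D) = alliance_count H (- int D)"
    and H: "\<And>w. w \<in> pverts H - {d} \<Longrightarrow> card (parcs H `` {w}) = r"
    and r: "r \<le> card (pverts G - {c})"
    and v: "v \<in> pverts G - {c}"
  shows "card (parcs G `` {v}) = r"
proof -
  interpret G: dominated_graph G c by fact
  interpret H: dominated_graph H d by fact
  \<comment> \<open>The sets containing the dominating vertices contribute equally on both sides and
    cancel.\<close>
  have same: "card {v \<in> G.R. card (parcs G `` {v}) = D} = card {w \<in> H.R. card (parcs H `` {w}) = D}"
    if "r \<le> D" "D \<le> card G.R" "\<And>v. v \<in> G.R \<Longrightarrow> card (parcs G `` {v}) \<le> D" for D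
  proof -
    have "card {T. T \<subseteq> G.R \<and> 2 * int (card T) - int (card G.R) = - int D} =
        card {T. T \<subseteq> H.R \<and> 2 * int (card T) - int (card H.R) = - int D}"
      unfolding card
      by (rule card_Collect_subset_card_cong[where P = "\<lambda>k. 2 * int k - int (card H.R) = - int D"])
        (simp_all add: card)
    then show ?thesis
      using G.alliance_count_minus[of D] H.alliance_count_minus[of D] counts[of D] that H by simp
  qed
  have bound: "\<forall>v\<in>G.R. card (parcs G `` {v}) \<le> D" if "r \<le> D" "D \<le> card G.R" for D
    using that(2,1)
  proof (induction D rule: inc_induct)
    case base
    have "card (parcs G `` {v}) \<le> card G.R" if "v \<in> G.R" for v
      using that G.max_degree_less G.degree_le_max[of v] G.c_vert G.card_pverts by fastforce
    then show ?case by blast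
  next
    case (step D)
    have "card {v \<in> G.R. card (parcs G `` {v}) = Suc D} = card {w \<in> H.R. card (parcs H `` {w}) = Suc D}"
      using step by (intro same) auto
    \<comment> \<open>\<open>Suc D\<close> exceeds \<open>r\<close>, the degree of all these
      vertices of \<open>H\<close>.\<close>
    also have "{w \<in> H.R. card (parcs H `` {w}) = Suc D} = {}" using H step.prems by auto
    finally have "{v \<in> G.R. card (parcs G `` {v}) = Suc D} = {}" by simp
    moreover have "\<forall>v\<in>G.R. card (parcs G `` {v}) \<le> Suc D" using step by auto
    ultimately show ?case by (auto simp: le_Suc_eq)
  qed
  \<comment> \<open>At \<open>D = r\<close> the count for \<open>H\<close> is everything, so by
    equal cardinality it is everything for \<open>G\<close>.\<close>
  have "card {v \<in> G.R. card (parcs G `` {v}) = r} = card {w \<in> H.R. card (parcs H `` {w}) = r}"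
    using bound[of r] r by (intro same) auto
  also have "{w \<in> H.R. card (parcs H `` {w}) = r} = H.R" using H by auto
  finally have "{v \<in> G.R. card (parcs G `` {v}) = r} = G.R"
    using card by (intro card_seteq) auto
  then show ?thesis using v by blast
qed

theorem theorem1:
  fixes G :: "'a pair_pre_digraph" and n :: nat
  assumes "n \<ge> 4"
    and "pair_graph G"
    and "pverts G \<noteq> {}"
    and "alliance_poly G = alliance_poly (wheel_graph n)"
  shows "digraph_iso (with_proj G) (with_proj (wheel_graph n))"
proof -
  define m where "m = n - 1"
  have m: "3 \<le> m" using assms(1) by (simp add: m_def)
  interpret pair_graph G by fact
  interpret W: dominated_graph "wheel_graph n" "Inl ()"
    using assms(1) by (rule dominated_graph_wheel)
  have W_R: "W.R = Inr ` {..<m}" by (auto simp: pverts_wheel m_def)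
  have card_W_R: "card W.R = m" by (simp add: W_R card_image)
  have W_ne: "pverts (wheel_graph n) \<noteq> {}" using W.c_vert by auto
  have W_deg: "card (parcs (wheel_graph n) `` {w}) = 3" if "w \<in> W.R" for w
    using that assms(1) degree_wheel_rim by (auto simp: W_R m_def)
  have counts: "alliance_count G (int i - int (card (pverts G))) =
      alliance_count (wheel_graph n) (int i - int (card (pverts (wheel_graph n))))" for i
    using coeff_alliance_poly[OF assms(3), of i] W.coeff_alliance_poly[OF W_ne, of i] assms(4) by simp

  \<comment> \<open>The witness \<open>{}\<close> in \<open>?Z\<close> stands for the centre taken
    alone, a connected set of index \<open>- int m\<close>.\<close>
  have "alliance_count (wheel_graph n) (- int m) \<noteq> 0"
  proof -
    let ?Z = "{T. T \<subseteq> W.R \<and> 2 * int (card T) - int (card W.R) = - int m}"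
    have "{} \<in> ?Z" using card_W_R by simp
    moreover have fin: "finite ?Z" by (rule finite_subset[of _ "Pow W.R"]) auto
    ultimately have "card ?Z \<noteq> 0" unfolding card_0_eq[OF fin] by blast
    moreover have "alliance_count (wheel_graph n) (- int m) =
        card {v \<in> W.R. card (parcs (wheel_graph n) `` {v}) = m} + card ?Z"
      using W_deg m by (intro W.alliance_count_minus) simp
    ultimately show ?thesis by linarith
  qed
  \<comment> \<open>The exponent 1 means index \<open>- int m\<close> in the wheel, and one minus
    the still unknown order in \<open>G\<close>.\<close>
  then have "alliance_count G (1 - int (card (pverts G))) \<noteq> 0"
    using counts[of 1] W.card_pverts card_W_R by simp
  then obtain c where "dominated_graph G c" using dominating_vertex by blast
  then interpret G: dominated_graph G c .

  have "card {S. S \<subseteq> pverts G \<and> conn_set (parcs G) S} =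
      card {S. S \<subseteq> pverts (wheel_graph n) \<and> conn_set (parcs (wheel_graph n)) S}"
    using poly_alliance_poly_1 W.poly_alliance_poly_1 unfolding assms(4)
    by (metis of_nat_eq_iff)
  then have total: "2 ^ card G.R + card {T. T \<subseteq> G.R \<and> conn_set (parcs G) T} =
      2 ^ card W.R + card {T. T \<subseteq> W.R \<and> conn_set (parcs (wheel_graph n)) T}"
    unfolding G.card_connected_sets W.card_connected_sets .
  then have card_R: "card G.R = card W.R"
    using power2_decomposition_unique G.card_connected_in_R_less W.card_connected_in_R_less by blast
  have conn: "card {T. T \<subseteq> G.R \<and> conn_set (parcs G) T} =
      card {T. T \<subseteq> W.R \<and> conn_set (parcs (wheel_graph n)) T}"
    using total card_R by simp

  have deg: "card (parcs G `` {v}) = 3" if "v \<in> G.R" for v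
  proof (rule degrees_eq_of_alliance_counts[OF G.dominated_graph_axioms W.dominated_graph_axioms])
    show "alliance_count G (- int D) = alliance_count (wheel_graph n) (- int D)"
      if "D \<le> card G.R" for D
      \<comment> \<open>Index \<open>- int D\<close> belongs to the exponent order minus
        \<open>D\<close>; the orders now agree.\<close>
      using counts[of "Suc (card G.R) - D"] that card_R
      by (simp add: G.card_pverts W.card_pverts)
  qed (use that card_R card_W_R m W_deg in auto)
  have reg: "card (G.R \<inter> parcs G `` {u}) = 2" if "u \<in> G.R" for u
  proof -
    have "c \<in> parcs G `` {u}" using that G.c_dom[of u] arcs_symmetric by auto
    moreover have "G.R \<inter> parcs G `` {u} = parcs G `` {u} - {c}" using in_arcsD2 by auto
    ultimately show ?thesis using deg[OF that] by simp
  qed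
  \<comment> \<open>This strict inequality rules out the second alternative of the counting lemma,
    so \<open>G.R\<close> is a single cycle.\<close>
  have "m\<^sup>2 < card {T. T \<subseteq> G.R \<and> conn_set (parcs G) T} + m"
    using card_connected_rim[OF assms(1)] by (simp add: conn W_R m_def)
  moreover have loopfree: "(u, u) \<notin> parcs G" for u using no_loops' by blast
  moreover note card_connected_subsets_two_regular[OF G.finite_R loopfree G.sym_parcs reg]
  ultimately obtain g where g: "inj_on g {..<m}" "g ` {..<m} = G.R" "\<And>k. g (k mod m) = g k"
    "\<And>k. G.R \<inter> parcs G `` {g (Suc k)} = {g k, g (Suc (Suc k))}"
    unfolding card_R card_W_R by auto

  have g_in: "g k \<in> G.R" for k
  proof -
    have "g (k mod m) \<in> g ` {..<m}" using m by (intro imageI) simp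
    then show ?thesis using g(2) g(3)[of k] by simp
  qed
  have g_arc: "(g i, g j) \<in> parcs G \<longleftrightarrow> j = Suc i mod m \<or> i = Suc j mod m" if "i < m" "j < m" for i j
  proof -
    have per: "g (k + m) = g k" for k using g(3)[of "k + m"] g(3)[of k] by simp
    have "g (Suc (i + (m - 1))) = g i" using per[of i] m by simp
    moreover have "g (Suc (Suc (i + (m - 1)))) = g (Suc i)" using per[of "Suc i"] m by simp
    ultimately have "(g i, g j) \<in> parcs G \<longleftrightarrow> g j = g (i + (m - 1)) \<or> g j = g (Suc i)"
      using g(4)[of "i + (m - 1)"] g_in[of j] by auto
    also have "\<dots> \<longleftrightarrow> g j = g ((i + (m - 1)) mod m) \<or> g j = g (Suc i mod m)"
      by (simp only: g(3))
    also have "\<dots> \<longleftrightarrow> j = (i + (m - 1)) mod m \<or> j = Suc i mod m"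
      using g(1) that m by (auto simp: inj_on_eq_iff)
    finally show ?thesis using eq_Suc_mod_iff[OF that] by auto
  qed
  \<comment> \<open>The dominating vertex goes to the centre, and the cycle vertex
    \<open>g i\<close> to the rim vertex \<open>i\<close>.\<close>
  define h where "h v = (if v = c then Inl () else Inr (the_inv_into {..<m} g v))" for v
  have h_c: "h c = Inl ()" by (simp add: h_def)
  have h_g: "h (g i) = Inr i" if "i < m" for i
    using that g(1) g_in[of i] by (simp add: h_def the_inv_into_f_f)
  have verts_G: "pverts G = insert c (g ` {..<m})" using g(2) G.c_vert by auto
  have "bij_betw h (pverts G) (pverts (wheel_graph n))"
  proof (rule bij_betw_imageI)
    show "inj_on h (pverts G)"
      unfolding verts_G by (auto simp: inj_on_def h_c h_g)
    have "h ` g ` {..<m} = Inr ` {..<m}" by (auto simp: image_image h_g)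
    then show "h ` pverts G = pverts (wheel_graph n)"
      by (simp add: verts_G pverts_wheel h_c m_def)
  qed
  moreover have "(u, v) \<in> parcs G \<longleftrightarrow> (h u, h v) \<in> parcs (wheel_graph n)"
    if "u \<in> pverts G" "v \<in> pverts G" for u v
  proof -
    have "(c, g i) \<in> parcs G" "(g i, c) \<in> parcs G" for i
      using G.c_dom[of "g i"] g_in[of i] arcs_symmetric by auto
    then show ?thesis
      using that loopfree[of c] unfolding verts_G
      by (auto simp: h_c h_g g_arc parcs_wheel[where n = n, folded m_def])
  qed
  ultimately show ?thesis
    using pair_wf_digraph_axioms W.pair_wf_digraph_axioms by (intro digraph_isoI)
qed

end
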